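(* The map $z\mapsto N_z$ is continuous from $\mathbb C$ into $\mathfrak F_{dist}(\mathbf 2)$.
   Context: Hermite functions: $H_n(z)=(-1)^ne^{z^2}(d/dz)^ne^{-z^2}$ and $\zeta_n(z)=\frac{1}{\pi^{1/4}2^{n/2}(n!)^{1/2}}(-1)^ne^{-z^2/2}H_n(z)$, $n=0,1,\ldots$; these are entire functions, orthonormal in $L_2(\mathbb R,dx)$. White noise space: $\mathscr S'_{\mathbb R}$ is the space of real tempered distributions on $\mathbb R$, $\mathcal C$ its cylinder sigma-algebra, and $P$ the probability measure (Bochner–Minlos) with $\int e^{i\langle s,\omega\rangle}dP(\omega)=e^{-\|s\|_2^2/2}$ for all real Schwartz functions $s$. $Z_n(\omega)=\langle\zeta_n,\omega\rangle$, $n=0,1,\ldots$, are independent $N(0,1)$ random variables. Let $\ell$ be the set of finitely supported sequences $\alpha=(\alpha_1,\alpha_2,\ldots)$ of non-negative integers, with $\alpha!=\prod_k\alpha_k!$. The functions $H_\alpha=\prod_{k\ge1}h_{\alpha_k}(Z_{k-1})$, where $h_n(x)=(-1)^ne^{x^2/2}(d/dx)^ne^{-x^2/2}$, form an orthogonal basis of $\mathbf L_2(\mathscr S'_{\mathbb R},\mathcal C,P)$ with $\|H_\alpha\|^2=\alpha!$. Elements $\sum_\alpha f_\alpha H_\alpha$ are identified with their coefficient families $(f_\alpha)_{\alpha\in\ell}$; in particular $Z_n$ is identified with the family equal to $1$ at $\alpha^{(n)}$ and $0$ elsewhere, where $\alpha^{(n)}\in\ell$ has $1$ in position $n+1$ and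 $0$ elsewhere. Stochastic distributions: let $b_\alpha=\prod_{k\ge1}(2^k)^{\alpha_k}$. For $p=1,2,\ldots$, $\mathcal F_{-p}$ is the Hilbert space of complex families $(f_\alpha)_{\alpha\in\ell}$ with $\|f\|_{-p}^2=\sum_{\alpha\in\ell}|f_\alpha|^2b_\alpha^{-p}<\infty$, and $\mathfrak F_{dist}(\mathbf 2)=\bigcup_{p\ge1}\mathcal F_{-p}$ with the inductive limit topology. Complex white noise: for $z\in\mathbb C$, $N_z=\sum_{n=0}^\infty\zeta_n(z)Z_n$, i.e. the family with coefficient $\zeta_n(z)$ at $\alpha^{(n)}$ ($n\ge0$) and $0$ at all other $\alpha\in\ell$. *)

theory Defs
  imports "HOL-Analysis.Analysis" "HOL-Library.Poly_Mapping"
begin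

section \<open>Hermite functions\<close>

definition hermite_poly :: "nat \<Rightarrow> complex \<Rightarrow> complex" where
  "hermite_poly n z = (-1) ^ n * exp (z\<^sup>2) * (deriv ^^ n) (\<lambda>w. exp (- (w\<^sup>2))) z"

definition hermite_fun :: "nat \<Rightarrow> complex \<Rightarrow> complex" where
  "hermite_fun n z =
     (-1) ^ n * exp (- (z\<^sup>2) / 2) * hermite_poly n z /
       of_real (pi powr (1/4) * 2 powr (real n / 2) * (fact n) powr (1/2))"

section \<open>Stochastic distributions\<close>

text \<open>
  A finitely supported sequence of non-negative integers is an element of
  \<^typ>\<open>nat \<Rightarrow>\<^sub>0 nat\<close>. Positions are counted from 0 here, so \<open>lookup \<alpha> k\<close> is the entry
  usually written \<open>\<alpha>\<^sub>k\<^sub>+\<^sub>1\<close>, and its base in the weight is \<open>2 ^ (k + 1)\<close>. A formal series in the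
  Hermite polynomials of the Gaussian variables is identified with its coefficient family.
\<close>

type_synonym family = "(nat \<Rightarrow>\<^sub>0 nat) \<Rightarrow> complex"

definition wt :: "(nat \<Rightarrow>\<^sub>0 nat) \<Rightarrow> real" where
  "wt \<alpha> = (\<Prod>k\<in>Poly_Mapping.keys \<alpha>. (2 ^ (k + 1)) ^ Poly_Mapping.lookup \<alpha> k)"

definition F_space :: "nat \<Rightarrow> family set" where
  "F_space p = {f. (\<lambda>\<alpha>. (cmod (f \<alpha>))\<^sup>2 / wt \<alpha> ^ p) summable_on UNIV}"

definition F_norm :: "nat \<Rightarrow> family \<Rightarrow> real" where
  "F_norm p f = sqrt (\<Sum>\<^sub>\<infinity>\<alpha>. (cmod (f \<alpha>))\<^sup>2 / wt \<alpha> ^ p)"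

definition F_top :: "nat \<Rightarrow> family topology" where
  "F_top p = Metric_space.mtopology (F_space p) (\<lambda>f g. F_norm p (\<lambda>\<alpha>. f \<alpha> - g \<alpha>))"

definition F_dist :: "family set" where
  "F_dist = (\<Union>p\<in>{1..}. F_space p)"

subsection \<open>The inductive limit topology\<close>

text \<open>
  Locally convex (not necessarily Hausdorff) topologies on a space \<open>E\<close> of families,
  with pointwise operations.
\<close>

definition convex_family_set :: "family set \<Rightarrow> bool" where
  "convex_family_set V \<longleftrightarrow>
     (\<forall>f\<in>V. \<forall>g\<in>V. \<forall>t\<in>{0..1::real}. (\<lambda>\<alpha>. of_real (1 - t) * f \<alpha> + of_real t * g \<alpha>) \<in> V)"

definition locally_convex_topology_on :: "family set \<Rightarrow> family topology \<Rightarrow> bool" where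
  "locally_convex_topology_on E T \<longleftrightarrow>
     topspace T = E \<and>
     continuous_map (prod_topology T T) T (\<lambda>(f, g). \<lambda>\<alpha>. f \<alpha> + g \<alpha>) \<and>
     continuous_map (prod_topology euclidean T) T (\<lambda>(c, f). \<lambda>\<alpha>. c * f \<alpha>) \<and>
     (\<forall>U. openin T U \<and> (\<lambda>_. 0) \<in> U \<longrightarrow>
        (\<exists>V. openin T V \<and> (\<lambda>_. 0) \<in> V \<and> V \<subseteq> U \<and> convex_family_set V))"

definition compatible_topology :: "family topology \<Rightarrow> bool" where
  "compatible_topology T \<longleftrightarrow>
     locally_convex_topology_on F_dist T \<and> (\<forall>p\<ge>1. continuous_map (F_top p) T (\<lambda>f. f))"

text \<open>
  The inductive limit topology is the finest locally convex topology making all the inclusions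
  continuous, obtained as the supremum of all such topologies; see \<open>compatible_F_dist_top\<close> and
  \<open>F_dist_top_finest\<close> below.
\<close>

definition F_dist_top :: "family topology" where
  "F_dist_top = topology_generated_by {U. \<exists>T. compatible_topology T \<and> openin T U}"

section \<open>Complex white noise\<close>

definition Z_fam :: "nat \<Rightarrow> family" where
  "Z_fam n \<alpha> = (if \<alpha> = Poly_Mapping.single n 1 then 1 else 0)"

text \<open>Coefficientwise sum: at each index at most one summand is nonzero.\<close>

definition N_fam :: "complex \<Rightarrow> family" where
  "N_fam z \<alpha> = suminf (\<lambda>n. hermite_fun n z * Z_fam n \<alpha>)"

lemma N_fam_single [simp]: "N_fam z (Poly_Mapping.single n 1) = hermite_fun n z"
proof -
  have *: "Poly_Mapping.single n (1::nat) = Poly_Mapping.single m 1 \<longleftrightarrow> m = n" for m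
    by (metis lookup_single_eq lookup_single_not_eq one_neq_zero)
  have "hermite_fun m z * Z_fam m (Poly_Mapping.single n 1)
      = (if m = n then hermite_fun m z else 0)" for m
    unfolding Z_fam_def * by simp
  then show ?thesis
    using sums_unique[OF sums_single[of n "\<lambda>m. hermite_fun m z"]] by (simp add: N_fam_def)
qed

lemma N_fam_other: "(\<And>n. \<alpha> \<noteq> Poly_Mapping.single n 1) \<Longrightarrow> N_fam z \<alpha> = 0"
  by (simp add: N_fam_def Z_fam_def)

section \<open>Basic facts\<close>

lemma wt_pos: "wt \<alpha> > 0"
  by (auto simp: wt_def intro!: prod_pos)

lemma F_norm_nonneg: "0 \<le> F_norm p f"
  unfolding F_norm_def
  by (intro real_sqrt_ge_zero infsum_nonneg divide_nonneg_nonneg) (auto simp: less_imp_le[OF wt_pos])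

lemma F_norm_sq: "(F_norm p f)\<^sup>2 = (\<Sum>\<^sub>\<infinity>\<alpha>. (cmod (f \<alpha>))\<^sup>2 / wt \<alpha> ^ p)"
  using wt_pos unfolding F_norm_def
  by (intro real_sqrt_pow2 infsum_nonneg divide_nonneg_nonneg) (auto intro: less_imp_le)

lemma L2_le_F_norm:
  assumes "f \<in> F_space p" "finite A"
  shows "L2_set (\<lambda>\<alpha>. cmod (f \<alpha>) / sqrt (wt \<alpha> ^ p)) A \<le> F_norm p f"
proof -
  have "(\<Sum>\<alpha>\<in>A. (cmod (f \<alpha>))\<^sup>2 / wt \<alpha> ^ p) \<le> (\<Sum>\<^sub>\<infinity>\<alpha>. (cmod (f \<alpha>))\<^sup>2 / wt \<alpha> ^ p)"
    using assms wt_pos by (intro finite_sum_le_infsum) (auto simp: F_space_def less_imp_le)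
  then show ?thesis
    using wt_pos by (simp add: L2_set_def F_norm_def power_divide less_imp_le)
qed

lemma F_space_add:
  assumes f: "f \<in> F_space p" and g: "g \<in> F_space p"
  shows "(\<lambda>\<alpha>. f \<alpha> + g \<alpha>) \<in> F_space p"
    and "F_norm p (\<lambda>\<alpha>. f \<alpha> + g \<alpha>) \<le> F_norm p f + F_norm p g"
proof -
  let ?h = "\<lambda>\<alpha>. (cmod (f \<alpha> + g \<alpha>))\<^sup>2 / wt \<alpha> ^ p"
  have nn: "0 \<le> ?h \<alpha>" for \<alpha>
    using wt_pos by (simp add: less_imp_le)
  have bd: "sum ?h A \<le> (F_norm p f + F_norm p g)\<^sup>2" if "finite A" for A
  proof -
    let ?s = "\<lambda>\<alpha>. sqrt (wt \<alpha> ^ p)"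
    have "sum ?h A = (L2_set (\<lambda>\<alpha>. cmod (f \<alpha> + g \<alpha>) / ?s \<alpha>) A)\<^sup>2"
      using wt_pos by (simp add: L2_set_def power_divide less_imp_le sum_nonneg)
    also have "\<dots> \<le> (L2_set (\<lambda>\<alpha>. cmod (f \<alpha>) / ?s \<alpha> + cmod (g \<alpha>) / ?s \<alpha>) A)\<^sup>2"
      using wt_pos by (intro power_mono L2_set_mono L2_set_nonneg)
        (auto simp: less_imp_le norm_triangle_ineq divide_right_mono simp flip: add_divide_distrib)
    also have "\<dots> \<le> (L2_set (\<lambda>\<alpha>. cmod (f \<alpha>) / ?s \<alpha>) A + L2_set (\<lambda>\<alpha>. cmod (g \<alpha>) / ?s \<alpha>) A)\<^sup>2"
      by (intro power_mono L2_set_triangle_ineq L2_set_nonneg)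
    also have "\<dots> \<le> (F_norm p f + F_norm p g)\<^sup>2"
      using L2_le_F_norm[OF f that] L2_le_F_norm[OF g that] by (intro power_mono add_mono) auto
    finally show ?thesis .
  qed
  have s: "?h summable_on UNIV"
    using bd nn by (intro nonneg_bdd_above_summable_on bdd_aboveI2) auto
  then show "(\<lambda>\<alpha>. f \<alpha> + g \<alpha>) \<in> F_space p"
    by (simp add: F_space_def)
  have "infsum ?h UNIV \<le> (F_norm p f + F_norm p g)\<^sup>2"
    using s bd by (intro infsum_le_finite_sums) auto
  then have "(F_norm p (\<lambda>\<alpha>. f \<alpha> + g \<alpha>))\<^sup>2 \<le> (F_norm p f + F_norm p g)\<^sup>2"
    unfolding F_norm_sq[of p "\<lambda>\<alpha>. f \<alpha> + g \<alpha>"] .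
  then show "F_norm p (\<lambda>\<alpha>. f \<alpha> + g \<alpha>) \<le> F_norm p f + F_norm p g"
    by (rule power2_le_imp_le) (intro add_nonneg_nonneg F_norm_nonneg)
qed

lemma F_space_scale: "f \<in> F_space p \<Longrightarrow> (\<lambda>\<alpha>. c * f \<alpha>) \<in> F_space p"
  using summable_on_cmult_right[of "\<lambda>\<alpha>. (cmod (f \<alpha>))\<^sup>2 / wt \<alpha> ^ p" UNIV "(cmod c)\<^sup>2"]
  by (simp add: F_space_def norm_mult power_mult_distrib)

lemma F_space_diff:
  "f \<in> F_space p \<Longrightarrow> g \<in> F_space p \<Longrightarrow> (\<lambda>\<alpha>. f \<alpha> - g \<alpha>) \<in> F_space p"
  using F_space_add(1)[of f p "\<lambda>\<alpha>. (-1) * g \<alpha>"] F_space_scale[of g p "-1"] by simp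

lemma F_norm_eq_0_iff:
  assumes "f \<in> F_space p"
  shows "F_norm p f = 0 \<longleftrightarrow> f = (\<lambda>_. 0)"
proof
  assume "F_norm p f = 0"
  then have "cmod (f \<alpha>) / sqrt (wt \<alpha> ^ p) \<le> 0" for \<alpha>
    using L2_le_F_norm[OF assms, of "{\<alpha>}"] wt_pos[of \<alpha>] by (simp add: L2_set_def)
  moreover have "0 < sqrt (wt \<alpha> ^ p)" for \<alpha>
    using wt_pos by simp
  ultimately have "cmod (f \<alpha>) \<le> 0" for \<alpha>
    by (meson divide_pos_pos not_le)
  then show "f = (\<lambda>_. 0)"
    by (simp add: fun_eq_iff)
qed (simp add: F_norm_def)

lemma Metric_space_F: "Metric_space (F_space p) (\<lambda>f g. F_norm p (\<lambda>\<alpha>. f \<alpha> - g \<alpha>))"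
proof
  fix f g h
  assume *: "f \<in> F_space p" "g \<in> F_space p" "h \<in> F_space p"
  show "F_norm p (\<lambda>\<alpha>. f \<alpha> - h \<alpha>) \<le> F_norm p (\<lambda>\<alpha>. f \<alpha> - g \<alpha>) + F_norm p (\<lambda>\<alpha>. g \<alpha> - h \<alpha>)"
    using F_space_add(2)[OF F_space_diff[OF *(1,2)] F_space_diff[OF *(2,3)]] by simp
next
  show "F_norm p (\<lambda>\<alpha>. f \<alpha> - g \<alpha>) = F_norm p (\<lambda>\<alpha>. g \<alpha> - f \<alpha>)" for f g
    by (simp add: F_norm_def norm_minus_commute)
next
  show "F_norm p (\<lambda>\<alpha>. f \<alpha> - g \<alpha>) = 0 \<longleftrightarrow> f = g" if "f \<in> F_space p" "g \<in> F_space p" for f g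
    using F_norm_eq_0_iff[OF F_space_diff[OF that]] by (simp add: fun_eq_iff)
qed (rule F_norm_nonneg)

lemma topspace_F_top [simp]: "topspace (F_top p) = F_space p"
  by (simp add: F_top_def Metric_space.topspace_mtopology[OF Metric_space_F])

lemma F_space_mono:
  assumes "p \<le> q"
  shows "F_space p \<subseteq> F_space q"
proof
  fix f assume f: "f \<in> F_space p"
  have "1 \<le> wt \<alpha>" for \<alpha>
    unfolding wt_def by (intro prod_ge_1 one_le_power) simp
  then have "(cmod (f \<alpha>))\<^sup>2 / wt \<alpha> ^ q \<le> (cmod (f \<alpha>))\<^sup>2 / wt \<alpha> ^ p" for \<alpha>
    using assms wt_pos by (intro divide_left_mono power_increasing) auto
  then show "f \<in> F_space q"
    using f wt_pos summable_on_comparison_test[of "\<lambda>\<alpha>. (cmod (f \<alpha>))\<^sup>2 / wt \<alpha> ^ p" UNIV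
        "\<lambda>\<alpha>. (cmod (f \<alpha>))\<^sup>2 / wt \<alpha> ^ q"]
    by (simp add: F_space_def less_imp_le)
qed

lemma F_dist_add: "f \<in> F_dist \<Longrightarrow> g \<in> F_dist \<Longrightarrow> (\<lambda>\<alpha>. f \<alpha> + g \<alpha>) \<in> F_dist"
proof -
  assume "f \<in> F_dist" "g \<in> F_dist"
  then obtain p q where "p \<ge> 1" "f \<in> F_space p" "g \<in> F_space q"
    by (auto simp: F_dist_def)
  then have "f \<in> F_space (max p q)" "g \<in> F_space (max p q)" "max p q \<ge> 1"
    using F_space_mono[of p "max p q"] F_space_mono[of q "max p q"] by auto
  then show ?thesis
    using F_space_add(1) unfolding F_dist_def by (intro UN_I[of "max p q"]) auto
qed

lemma F_dist_scale: "f \<in> F_dist \<Longrightarrow> (\<lambda>\<alpha>. c * f \<alpha>) \<in> F_dist"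
  by (auto simp: F_dist_def intro: F_space_scale)

lemma compatible_indiscrete: "compatible_topology (topology_generated_by {F_dist})"
  unfolding compatible_topology_def locally_convex_topology_on_def
proof (intro conjI allI impI)
  let ?T = "topology_generated_by {F_dist}"
  show "topspace ?T = F_dist" by simp
  have ci: "continuous_map X ?T h" if "\<And>x. x \<in> topspace X \<Longrightarrow> h x \<in> F_dist"
    for X :: "'x topology" and h
  proof (rule continuous_on_generated_topo)
    show "openin X (h -` U \<inter> topspace X)" if "U \<in> {F_dist}" for U
    proof -
      have "h -` U \<inter> topspace X = topspace X"
        using that \<open>\<And>x. x \<in> topspace X \<Longrightarrow> h x \<in> F_dist\<close> by auto
      then show ?thesis by simp
    qed
  qed (use that in auto)
  show "continuous_map (prod_topology ?T ?T) ?T (\<lambda>(f, g). \<lambda>\<alpha>. f \<alpha> + g \<alpha>)"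
    by (rule ci) (auto simp: F_dist_add)
  show "continuous_map (prod_topology euclidean ?T) ?T (\<lambda>(c, f). \<lambda>\<alpha>. c * f \<alpha>)"
    by (rule ci) (auto simp: F_dist_scale)
  show "continuous_map (F_top p) ?T (\<lambda>f. f)" if "p \<ge> 1" for p
    by (rule ci) (use that in \<open>auto simp: F_dist_def\<close>)
  fix U assume U: "openin ?T U \<and> (\<lambda>_. 0) \<in> U"
  have "generate_topology_on {F_dist} W \<Longrightarrow> W = {} \<or> W = F_dist" for W
  proof (induction rule: generate_topology_on.induct)
    case (UN K)
    then show ?case by (cases "F_dist \<in> K") auto
  qed auto
  then have "U = F_dist"
    using U by (auto simp: openin_topology_generated_by_iff)
  moreover have "convex_family_set F_dist"
    by (auto simp: convex_family_set_def intro!: F_dist_add F_dist_scale)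
  ultimately show "\<exists>V. openin ?T V \<and> (\<lambda>_. 0) \<in> V \<and> V \<subseteq> U \<and> convex_family_set V"
    using U by blast
qed

lemma topspace_F_dist_top [simp]: "topspace F_dist_top = F_dist"
proof
  have "U \<subseteq> F_dist" if "compatible_topology T" "openin T U" for T U
    using that openin_subset[of T U]
    by (simp add: compatible_topology_def locally_convex_topology_on_def)
  then show "topspace F_dist_top \<subseteq> F_dist"
    unfolding F_dist_top_def topology_generated_by_topspace by blast
  have "openin (topology_generated_by {F_dist}) F_dist"
    by (simp add: topology_generated_by_Basis)
  then show "F_dist \<subseteq> topspace F_dist_top"
    unfolding F_dist_top_def topology_generated_by_topspace
    using compatible_indiscrete by blast
qed

lemma F_dist_top_finest:
  "compatible_topology T \<Longrightarrow> openin T U \<Longrightarrow> openin F_dist_top U"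
  unfolding F_dist_top_def by (rule topology_generated_by_Basis) blast

lemma continuous_map_into_F_dist_top:
  assumes "\<And>x. x \<in> topspace X \<Longrightarrow> h x \<in> F_dist"
    and "\<And>T. compatible_topology T \<Longrightarrow> continuous_map X T h"
  shows "continuous_map X F_dist_top h"
  unfolding F_dist_top_def
proof (rule continuous_on_generated_topo)
  show "openin X (h -` U \<inter> topspace X)"
    if U: "U \<in> {U. \<exists>T. compatible_topology T \<and> openin T U}" for U
  proof -
    obtain T where "compatible_topology T" "openin T U"
      using U by blast
    then have "openin X {x \<in> topspace X. h x \<in> U}"
      using assms(2) openin_continuous_map_preimage by blast
    then show ?thesis
      by (simp add: vimage_def Int_def conj_commute)
  qed
  show "h ` topspace X \<subseteq> \<Union> {U. \<exists>T. compatible_topology T \<and> openin T U}"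
    using assms(1) topspace_F_dist_top unfolding F_dist_top_def topology_generated_by_topspace
    by blast
qed

lemma compatible_F_dist_top: "compatible_topology F_dist_top"
  unfolding compatible_topology_def locally_convex_topology_on_def
proof (intro conjI allI impI)
  have tc: "topspace T = F_dist" "continuous_map F_dist_top T (\<lambda>f. f)"
    if "compatible_topology T" for T
  proof -
    show T: "topspace T = F_dist"
      using that by (simp add: compatible_topology_def locally_convex_topology_on_def)
    have "openin F_dist_top {x \<in> F_dist. x \<in> U}" if "openin T U" for U
    proof -
      have "{x \<in> F_dist. x \<in> U} = U"
        using openin_subset[OF that] T by blast
      then show ?thesis
        using F_dist_top_finest[OF \<open>compatible_topology T\<close> that] by simp
    qed
    then show "continuous_map F_dist_top T (\<lambda>f. f)"
      by (simp add: continuous_map_def T Pi_iff)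
  qed
  show "topspace F_dist_top = F_dist" by simp
  show "continuous_map (F_top p) F_dist_top (\<lambda>f. f)" if "p \<ge> 1" for p
    using that by (intro continuous_map_into_F_dist_top) (auto simp: F_dist_def compatible_topology_def)
  show "continuous_map (prod_topology F_dist_top F_dist_top) F_dist_top (\<lambda>(f, g). \<lambda>\<alpha>. f \<alpha> + g \<alpha>)"
  proof (rule continuous_map_into_F_dist_top)
    fix T assume T: "compatible_topology T"
    have "continuous_map (prod_topology F_dist_top F_dist_top) (prod_topology T T) (\<lambda>(f, g). (f, g))"
      by (rule iffD2[OF continuous_map_prod_top]) (simp add: tc(2)[OF T])
    moreover have "continuous_map (prod_topology T T) T (\<lambda>(f, g). \<lambda>\<alpha>. f \<alpha> + g \<alpha>)"
      using T by (simp add: compatible_topology_def locally_convex_topology_on_def)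
    ultimately show "continuous_map (prod_topology F_dist_top F_dist_top) T (\<lambda>(f, g). \<lambda>\<alpha>. f \<alpha> + g \<alpha>)"
      using continuous_map_compose by (fastforce simp: o_def)
  qed (auto simp: F_dist_add)
  show "continuous_map (prod_topology euclidean F_dist_top) F_dist_top (\<lambda>(c, f). \<lambda>\<alpha>. c * f \<alpha>)"
  proof (rule continuous_map_into_F_dist_top)
    fix T assume T: "compatible_topology T"
    have "continuous_map (prod_topology euclidean F_dist_top) (prod_topology euclidean T) (\<lambda>(c, f). (c, f))"
      by (rule iffD2[OF continuous_map_prod_top]) (simp add: tc(2)[OF T])
    moreover have "continuous_map (prod_topology euclidean T) T (\<lambda>(c, f). \<lambda>\<alpha>. c * f \<alpha>)"
      using T by (simp add: compatible_topology_def locally_convex_topology_on_def)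
    ultimately show "continuous_map (prod_topology euclidean F_dist_top) T (\<lambda>(c, f). \<lambda>\<alpha>. c * f \<alpha>)"
      using continuous_map_compose by (fastforce simp: o_def)
  qed (auto simp: F_dist_scale)
  fix U assume U: "openin F_dist_top U \<and> (\<lambda>_. 0) \<in> U"
  let ?V = "\<lambda>U. \<exists>V. openin F_dist_top V \<and> (\<lambda>_. 0) \<in> V \<and> V \<subseteq> U \<and> convex_family_set V"
  have "(\<lambda>_. 0) \<in> W \<longrightarrow> ?V W"
    if "generate_topology_on {U. \<exists>T. compatible_topology T \<and> openin T U} W" for W
    using that
  proof (induction rule: generate_topology_on.induct)
    case (Int A B)
    show ?case
    proof
      assume "(\<lambda>_. 0) \<in> A \<inter> B"
      then obtain V V' where
        "openin F_dist_top V" "(\<lambda>_. 0) \<in> V" "V \<subseteq> A" "convex_family_set V"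
        "openin F_dist_top V'" "(\<lambda>_. 0) \<in> V'" "V' \<subseteq> B" "convex_family_set V'"
        using Int.IH by blast
      then show "?V (A \<inter> B)"
        by (intro exI[of _ "V \<inter> V'"]) (auto simp: convex_family_set_def)
    qed
  next
    case (UN K)
    show ?case
    proof
      assume "(\<lambda>_. 0) \<in> \<Union> K"
      then obtain A where "A \<in> K" "(\<lambda>_. 0) \<in> A" by blast
      then show "?V (\<Union> K)"
        using UN.IH[of A] by (meson Union_upper order_trans)
    qed
  next
    case (Basis A)
    then obtain T where T: "compatible_topology T" "openin T A" by blast
    show ?case
    proof
      assume "(\<lambda>_. 0) \<in> A"
      then have "\<exists>V. openin T V \<and> (\<lambda>_. 0) \<in> V \<and> V \<subseteq> A \<and> convex_family_set V"
        using T unfolding compatible_topology_def locally_convex_topology_on_def by blast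
      then show "?V A"
        using F_dist_top_finest[OF T(1)] by blast
    qed
  qed simp
  then show "?V U"
    using U unfolding F_dist_top_def openin_topology_generated_by_iff by blast
qed

end

theory Submission
  imports Defs "HOL-Complex_Analysis.Cauchy_Integral_Formula"
begin

text \<open>
  On a disc of radius \<open>R\<close>, Cauchy's inequality for \<open>exp (-w\<^sup>2)\<close> on the circle of radius
  \<open>sqrt (n + 1)\<close> yields \<open>\<bar>\<zeta>\<^sub>n z\<bar> \<le> C\<^sub>R * exp (2 * n)\<close>: with this radius
  \<open>sqrt (n!) / r ^ n \<le> 1\<close>, so the factorials cancel against the normalization. Since
  \<open>exp 4 < 2 ^ 7\<close>, the squared norm of \<open>N\<^sub>z - N\<^sub>w\<close> of order \<open>-7\<close> is a series of continuous
  functions of \<open>w\<close> with a geometric majorant, hence tends to \<open>0\<close> as \<open>w\<close> tends to \<open>z\<close>. So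
  \<open>N\<close> is already continuous into a single step of the inductive limit.
\<close>

lemma norm_exp_le_exp: "cmod z \<le> b \<Longrightarrow> cmod (exp z) \<le> exp b"
  by (rule order_trans[OF norm_exp]) simp

lemma hermite_fun_bound:
  assumes "cmod z \<le> R"
  shows "cmod (hermite_fun n z) \<le> exp (4 * R\<^sup>2 + 2) * exp 2 ^ n"
proof -
  \<comment> \<open>The \<open>+ 1\<close> keeps the radius positive at n = 0, where Cauchy's
    inequality must still apply.\<close>
  define r where "r = sqrt (real n + 1)"
  have r: "r > 0" "r\<^sup>2 = real n + 1"
    by (simp_all add: r_def)
  have R2: "(cmod z)\<^sup>2 \<le> R\<^sup>2"
    using assms by (intro power_mono) auto
  have deriv: "cmod ((deriv ^^ n) (\<lambda>w. exp (- (w\<^sup>2))) z) \<le> fact n * exp (2 * R\<^sup>2 + 2 * r\<^sup>2) / r ^ n"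
  proof (rule Cauchy_inequality)
    fix x assume x: "cmod (z - x) = r"
    have "cmod x \<le> R + r"
      using x assms norm_triangle_ineq4[of z "z - x"] by simp
    then have "(cmod x)\<^sup>2 \<le> (R + r)\<^sup>2"
      by (intro power_mono) auto
    \<comment> \<open>2Rr \<le> R^2 + r^2 removes the mixed term, so the dependence on the disc
      separates from that on n.\<close>
    also have "\<dots> \<le> 2 * R\<^sup>2 + 2 * r\<^sup>2"
      using sum_squares_bound[of R r] by (simp add: power2_sum)
    finally show "cmod (exp (- (x\<^sup>2))) \<le> exp (2 * R\<^sup>2 + 2 * r\<^sup>2)"
      by (intro norm_exp_le_exp) (simp add: norm_power)
  qed (use r in \<open>auto intro!: holomorphic_intros continuous_intros\<close>)
  have exp1: "cmod (exp (z\<^sup>2)) \<le> exp (R\<^sup>2)"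
    using R2 by (intro norm_exp_le_exp) (simp add: norm_power)
  have exp2: "cmod (exp (- (z\<^sup>2) / 2)) \<le> exp (R\<^sup>2)"
  proof (rule norm_exp_le_exp)
    have "cmod (- (z\<^sup>2) / 2) = (cmod z)\<^sup>2 / 2"
      by (simp add: norm_power norm_divide)
    then show "cmod (- (z\<^sup>2) / 2) \<le> R\<^sup>2"
      using R2 zero_le_power2[of R] by linarith
  qed
  have "cmod ((-1) ^ n * exp (- (z\<^sup>2) / 2) * hermite_poly n z)
      = cmod (exp (- (z\<^sup>2) / 2)) *
        (cmod (exp (z\<^sup>2)) * cmod ((deriv ^^ n) (\<lambda>w. exp (- (w\<^sup>2))) z))"
    by (simp add: hermite_poly_def norm_mult norm_power)
  also have "\<dots> \<le> exp (R\<^sup>2) * (exp (R\<^sup>2) * (fact n * exp (2 * R\<^sup>2 + 2 * r\<^sup>2) / r ^ n))"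
    using exp2 exp1 deriv by (intro mult_mono mult_nonneg_nonneg norm_ge_zero exp_ge_zero)
  also have "\<dots> = exp (R\<^sup>2) * (exp (R\<^sup>2) * exp (2 * R\<^sup>2 + 2 * r\<^sup>2)) * (fact n / r ^ n)"
    by simp
  \<comment> \<open>As r^2 = n + 1, the exponents add up to 4R^2 + 2 + 2n.\<close>
  also have "exp (R\<^sup>2) * (exp (R\<^sup>2) * exp (2 * R\<^sup>2 + 2 * r\<^sup>2)) = exp (4 * R\<^sup>2 + 2) * exp 2 ^ n"
    unfolding exp_of_nat_mult[symmetric] mult_exp_exp r(2) by (simp add: algebra_simps)
  finally have num: "cmod ((-1) ^ n * exp (- (z\<^sup>2) / 2) * hermite_poly n z)
      \<le> exp (4 * R\<^sup>2 + 2) * exp 2 ^ n * (fact n / r ^ n)" .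
  \<comment> \<open>n! \<le> n^n \<le> r^(2n), so dividing by r^n costs at least a factor sqrt
    (n!).\<close>
  have "(fact n :: real) \<le> real n ^ n"
    using fact_le_power[of n] by simp
  also have "\<dots> \<le> (real n + 1) ^ n"
    by (intro power_mono) auto
  finally have "sqrt (fact n) \<le> r ^ n"
    by (simp add: r_def flip: real_sqrt_power)
  then have "sqrt (fact n) * sqrt (fact n) \<le> sqrt (fact n) * r ^ n"
    by (intro mult_left_mono) auto
  then have fact: "fact n / r ^ n \<le> sqrt (fact n)"
    using r by (simp add: divide_simps)
  define d :: real where "d = pi powr (1/4) * 2 powr (real n / 2) * fact n powr (1/2)"
  \<comment> \<open>The factors pi^(1/4) and 2^(n/2) are at least 1, so the normalization alone
    absorbs the remaining sqrt (n!).\<close>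
  have "1 * 1 * sqrt (fact n) \<le> d"
    unfolding d_def powr_half_sqrt[OF fact_ge_zero]
    using pi_gt3 by (intro mult_mono ge_one_powr_ge_zero) auto
  then have d: "sqrt (fact n) \<le> d" "d > 0"
    by (auto intro: less_le_trans[of 0 "sqrt (fact n)"])
  have "cmod ((-1) ^ n * exp (- (z\<^sup>2) / 2) * hermite_poly n z)
      \<le> exp (4 * R\<^sup>2 + 2) * exp 2 ^ n * d"
    using num fact d(1) by (elim order_trans) (intro mult_left_mono; simp)
  then show ?thesis
    using d(2) unfolding hermite_fun_def d_def[symmetric]
    by (simp add: norm_divide divide_simps)
qed

lemma continuous_on_hermite_fun: "continuous_on S (hermite_fun n)"
proof -
  have "(\<lambda>w. exp (- (w\<^sup>2)) :: complex) holomorphic_on UNIV"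
    by (intro holomorphic_intros)
  then have "(deriv ^^ n) (\<lambda>w. exp (- (w\<^sup>2)) :: complex) holomorphic_on UNIV"
    by (rule holomorphic_higher_deriv) simp
  then have "continuous_on S ((deriv ^^ n) (\<lambda>w. exp (- (w\<^sup>2)) :: complex))"
    using holomorphic_on_imp_continuous_on continuous_on_subset by blast
  then show ?thesis
    unfolding hermite_fun_def hermite_poly_def by (intro continuous_intros) auto
qed

lemma wt_single: "wt (Poly_Mapping.single n 1) = 2 ^ (n + 1)"
  by (simp add: wt_def)

text \<open>Reduces the sum over all multi-indices to an ordinary series: n \<mapsto>
  \<open>Poly_Mapping.single n 1\<close> is injective and \<open>f\<close> vanishes off its
  range.\<close>

lemma F_norm_first_chaos:
  fixes f :: family
  assumes "\<And>\<alpha>. \<alpha> \<notin> range (\<lambda>n. Poly_Mapping.single n 1) \<Longrightarrow> f \<alpha> = 0"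
    and "summable (\<lambda>n. (cmod (f (Poly_Mapping.single n 1)))\<^sup>2 / (2 ^ (n + 1)) ^ p)"
  shows "f \<in> F_space p"
    and "(F_norm p f)\<^sup>2 = suminf (\<lambda>n. (cmod (f (Poly_Mapping.single n 1)))\<^sup>2 / (2 ^ (n + 1)) ^ p)"
proof -
  let ?e = "\<lambda>n::nat. Poly_Mapping.single n (1::nat)"
  let ?h = "\<lambda>\<alpha>. (cmod (f \<alpha>))\<^sup>2 / wt \<alpha> ^ p"
  have inj: "inj ?e"
  proof (rule injI)
    fix m n assume "?e m = ?e n"
    from arg_cong[OF this, of "\<lambda>\<alpha>. Poly_Mapping.lookup \<alpha> n"] show "m = n"
      by (simp add: lookup_single when_def split: if_splits)
  qed
  \<comment> \<open>The terms are nonnegative, so convergence of the series is absolute and gives an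
    unordered sum.\<close>
  have "(?h \<circ> ?e has_sum (suminf (\<lambda>n. (cmod (f (?e n)))\<^sup>2 / (2 ^ (n + 1)) ^ p))) UNIV"
    unfolding o_def wt_single using assms(2)
    by (intro norm_summable_imp_has_sum summable_sums) auto
  then have "(?h has_sum (suminf (\<lambda>n. (cmod (f (?e n)))\<^sup>2 / (2 ^ (n + 1)) ^ p))) (range ?e)"
    using has_sum_reindex[OF inj] by blast
  then have "(?h has_sum (suminf (\<lambda>n. (cmod (f (?e n)))\<^sup>2 / (2 ^ (n + 1)) ^ p))) UNIV"
    by (rule has_sum_cong_neutral[THEN iffD1, rotated -1]) (use assms(1) in auto)
  then show "f \<in> F_space p"
    and "(F_norm p f)\<^sup>2 = suminf (\<lambda>n. (cmod (f (?e n)))\<^sup>2 / (2 ^ (n + 1)) ^ p)"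
    by (auto simp: F_space_def F_norm_sq summable_on_def infsumI)
qed

text \<open>The order 7 comes from e \<le> 3: squaring the growth gives exp 4 \<le> 81 per step,
  against the weight 2^7 = 128.\<close>

lemma weighted_square_bound:
  fixes C x :: real
  assumes "0 \<le> C" "x \<le> C * exp 2 ^ n" "0 \<le> x"
  shows "x\<^sup>2 / (2 ^ (n + 1)) ^ 7 \<le> C\<^sup>2 * (81 / 128) ^ n"
proof -
  have "exp (4::real) = exp 1 ^ 4"
    by (simp flip: exp_of_nat_mult)
  also have "\<dots> \<le> 3 ^ 4"
    by (intro power_mono exp_le) auto
  finally have e: "exp (4::real) \<le> 81" by simp
  have "x\<^sup>2 \<le> (C * exp 2 ^ n)\<^sup>2"
    using assms by (intro power_mono) auto
  also have "\<dots> = C\<^sup>2 * exp 4 ^ n"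
    by (simp add: power_mult_distrib flip: exp_of_nat_mult)
  also have "\<dots> \<le> C\<^sup>2 * 81 ^ n"
    using e by (intro mult_left_mono power_mono) auto
  finally have x: "x\<^sup>2 \<le> C\<^sup>2 * 81 ^ n" .
  have "(2 ^ (n + 1)) ^ 7 = (2 ^ 7 :: real) ^ (n + 1)"
    by (metis power_mult mult.commute)
  then have "128 ^ n \<le> ((2 ^ (n + 1)) ^ 7 :: real)"
    by simp
  with x have "x\<^sup>2 / (2 ^ (n + 1)) ^ 7 \<le> C\<^sup>2 * 81 ^ n / 128 ^ n"
    by (intro frac_le) auto
  then show ?thesis
    by (simp add: power_divide)
qed

lemma N_fam_in_F_space: "N_fam z \<in> F_space 7"
proof (rule F_norm_first_chaos(1))
  let ?C = "exp (4 * (cmod z)\<^sup>2 + 2)"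
  show "summable (\<lambda>n. (cmod (N_fam z (Poly_Mapping.single n 1)))\<^sup>2 / (2 ^ (n + 1)) ^ 7)"
  proof (rule summable_comparison_test')
    show "summable (\<lambda>n. ?C\<^sup>2 * (81 / 128) ^ n :: real)"
      by (intro summable_mult summable_geometric) auto
    show "norm ((cmod (N_fam z (Poly_Mapping.single n 1)))\<^sup>2 / (2 ^ (n + 1)) ^ 7)
        \<le> ?C\<^sup>2 * (81 / 128) ^ n" if "n \<ge> 0" for n
      \<comment> \<open>Deleting \<open>One_nat_def\<close> preserves the form of index that
        \<open>N_fam_single\<close> rewrites.\<close>
      using weighted_square_bound[OF _ hermite_fun_bound[OF order_refl], of z n]
      by (simp del: One_nat_def)
  qed
qed (use N_fam_other in blast)

lemma tendsto_F_norm_N_fam: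
  "((\<lambda>w. F_norm 7 (\<lambda>\<alpha>. N_fam z \<alpha> - N_fam w \<alpha>)) \<longlongrightarrow> 0) (at z)"
proof -
  \<comment> \<open>The disc of radius \<open>R\<close> about 0 contains the unit ball about
    \<open>z\<close>, so one majorant serves all \<open>w\<close> there; the 2 in \<open>C\<close>
    pays for the triangle inequality.\<close>
  define R where "R = cmod z + 1"
  define C where "C = 2 * exp (4 * R\<^sup>2 + 2)"
  define g where "g = (\<lambda>n w. (cmod (hermite_fun n z - hermite_fun n w))\<^sup>2 / (2 ^ (n + 1)) ^ 7)"
  have bd: "norm (g n w) \<le> C\<^sup>2 * (81 / 128) ^ n" if "w \<in> ball z 1" for n w
  proof -
    have "cmod z \<le> R" "cmod w \<le> R"
      using that norm_triangle_ineq2[of w z] by (auto simp: R_def dist_norm norm_minus_commute)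
    then have "cmod (hermite_fun n z - hermite_fun n w) \<le> C * exp 2 ^ n"
      using hermite_fun_bound[of z R n] hermite_fun_bound[of w R n]
        norm_triangle_ineq4[of "hermite_fun n z" "hermite_fun n w"] by (simp add: C_def)
    from weighted_square_bound[OF _ this] show ?thesis
      by (simp add: g_def C_def)
  qed
  have sm: "summable (\<lambda>n. C\<^sup>2 * (81 / 128) ^ n)"
    by (intro summable_mult summable_geometric) auto
  have eq: "F_norm 7 (\<lambda>\<alpha>. N_fam z \<alpha> - N_fam w \<alpha>) = sqrt (suminf (\<lambda>n. g n w))"
    if "w \<in> ball z 1" for w
  proof -
    have "summable (\<lambda>n. g n w)"
      using bd[OF that] sm by (rule summable_comparison_test'[rotated])
    then have "(F_norm 7 (\<lambda>\<alpha>. N_fam z \<alpha> - N_fam w \<alpha>))\<^sup>2 = suminf (\<lambda>n. g n w)"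
      by (subst F_norm_first_chaos(2))
        (auto simp: g_def image_def N_fam_other simp flip: One_nat_def)
    then show ?thesis
      by (metis F_norm_nonneg real_sqrt_unique)
  qed
  \<comment> \<open>The geometric majorant makes the convergence uniform, which carries continuity
    in \<open>w\<close> from the partial sums to the series.\<close>
  have "uniform_limit (ball z 1) (\<lambda>m w. \<Sum>n<m. g n w) (\<lambda>w. suminf (\<lambda>n. g n w)) sequentially"
    using bd sm by (rule Weierstrass_m_test)
  moreover have "continuous_on (ball z 1) (\<lambda>w. \<Sum>n<m. g n w)" for m
    unfolding g_def by (intro continuous_intros continuous_on_hermite_fun) auto
  ultimately have "continuous_on (ball z 1) (\<lambda>w. suminf (\<lambda>n. g n w))"
    by (intro uniform_limit_theorem[rotated]) auto
  then have "continuous_on (ball z 1) (\<lambda>w. sqrt (suminf (\<lambda>n. g n w)))"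
    by (rule continuous_on_real_sqrt)
  then have "((\<lambda>w. sqrt (suminf (\<lambda>n. g n w))) \<longlongrightarrow> sqrt (suminf (\<lambda>n. g n z))) (at z)"
    using continuous_on_interior[of "ball z 1" "\<lambda>w. sqrt (suminf (\<lambda>n. g n w))" z]
    by (simp add: isCont_def)
  moreover have "\<forall>\<^sub>F w in at z. w \<in> ball z 1"
    by (intro eventually_at_in_open') auto
  ultimately have "((\<lambda>w. F_norm 7 (\<lambda>\<alpha>. N_fam z \<alpha> - N_fam w \<alpha>))
      \<longlongrightarrow> sqrt (suminf (\<lambda>n. g n z))) (at z)"
    by (elim Lim_transform_eventually) (auto elim: eventually_mono simp: eq simp del: mem_ball)
  \<comment> \<open>Every term \<open>g n z\<close> is 0, so the limit found is 0.\<close>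
  then show ?thesis
    by (simp add: g_def)
qed

theorem theorem6p2:
  shows "continuous_map euclidean F_dist_top N_fam"
proof -
  interpret Metric_space "F_space 7" "\<lambda>f g. F_norm 7 (\<lambda>\<alpha>. f \<alpha> - g \<alpha>)"
    by (rule Metric_space_F)
  have "continuous_map euclidean (F_top 7) N_fam"
    unfolding F_top_def continuous_map_to_metric
  proof (intro ballI allI impI)
    fix z and \<epsilon> :: real assume "\<epsilon> > 0"
    \<comment> \<open>The punctured limit extends to \<open>nhds z\<close> because the distance
      vanishes at w = z.\<close>
    then have "\<forall>\<^sub>F w in nhds z. F_norm 7 (\<lambda>\<alpha>. N_fam z \<alpha> - N_fam w \<alpha>) < \<epsilon>"
      using order_tendstoD(2)[OF tendsto_F_norm_N_fam[of z]]
      by (simp add: eventually_nhds_conv_at F_norm_def)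
    then show "\<exists>U. openin euclidean U \<and> z \<in> U \<and> (\<forall>w\<in>U. N_fam w \<in> mball (N_fam z) \<epsilon>)"
      by (auto simp: eventually_nhds N_fam_in_F_space)
  qed
  \<comment> \<open>The inductive limit topology is itself compatible, so the inclusion of the step
    of order 7 is continuous.\<close>
  moreover have "continuous_map (F_top 7) F_dist_top (\<lambda>f. f)"
    using compatible_F_dist_top by (simp add: compatible_topology_def)
  ultimately show ?thesis
    using continuous_map_compose by (fastforce simp: o_def)
qed

end
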